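(* Every pointed factor permutable category is strongly centralic.
   Context: A regular category $\mathbb{C}$ is factor permutable if for every object $A$, every (internal) equivalence relation $E$ on $A$ and every product projection $p\colon A\to X$ of $A$ (i.e. one of the projections of a representation of $A$ as a binary product), one has $\mathsf{Eq}(p)\circ E=E\circ\mathsf{Eq}(p)$, where $\mathsf{Eq}(p)$ is the kernel equivalence relation of $p$ (represented by its kernel pair) and $\circ$ is composition of relations. A pointed category is a category with a zero object $0$; zero morphisms are also denoted $0$. For morphisms $x\colon S\to X$, $y\colon S\to Y$, $f\colon X\times Y\to Z$, write $f(x,y)$ for the composite $f\circ(x,y)\colon S\to Z$. A pointed category with finite products is called centralic if for every morphism $f\colon X\times Y\to Z$, every object $S$ and all morphisms $x,x'\colon S\to X$, $y\colon S\to Y$: $f(x,0)=f(x',0)$ implies $f(x,y)=f(x',y)$. A pointed category is strongly centralic if it is centralic and satisfies condition $\mathsf{(S)}$: for any object $X$, any monomorphism $m\colon W\to Y$ and any morphisms $\phi\colon X\times X\to Y$, $f\colon X\to W$ with $\phi\circ(1_X,0)=m\circ f=\phi\circ(0,1_X)$, there exists a morphism $\psi\colon X\times X\to W$ with $m\circ\psi=\phi$. *)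

theory Defs
  imports Main
begin

section \<open>Categories\<close>

record ('o, 'm) precategory =
  Ob :: "'o set"
  Ar :: "'m set"
  Dom :: "'m \<Rightarrow> 'o"
  Cod :: "'m \<Rightarrow> 'o"
  Ident :: "'o \<Rightarrow> 'm"
  Comp :: "'m \<Rightarrow> 'm \<Rightarrow> 'm"  (infixr "\<cdot>\<index>" 70)

definition hom :: "('o, 'm) precategory \<Rightarrow> 'o \<Rightarrow> 'o \<Rightarrow> 'm set" where
  "hom C A B = {f \<in> Ar C. Dom C f = A \<and> Cod C f = B}"

text \<open>Composition is written in the usual order (\<open>g \<cdot> f\<close> is "first \<open>f\<close>, then \<open>g\<close>"), and its values
  on non-composable pairs are irrelevant.\<close>

locale category =
  fixes C :: "('o, 'm) precategory"  (structure)
  assumes Dom_in_Ob: "f \<in> Ar C \<Longrightarrow> Dom C f \<in> Ob C"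
    and Cod_in_Ob: "f \<in> Ar C \<Longrightarrow> Cod C f \<in> Ob C"
    and Ident_in_hom: "A \<in> Ob C \<Longrightarrow> Ident C A \<in> hom C A A"
    and Comp_in_hom: "\<lbrakk>f \<in> hom C A B; g \<in> hom C B D\<rbrakk> \<Longrightarrow> g \<cdot> f \<in> hom C A D"
    and Comp_Ident: "f \<in> hom C A B \<Longrightarrow> f \<cdot> Ident C A = f"
    and Ident_Comp: "f \<in> hom C A B \<Longrightarrow> Ident C B \<cdot> f = f"
    and Comp_assoc: "\<lbrakk>f \<in> hom C A B; g \<in> hom C B D; h \<in> hom C D E\<rbrakk>
      \<Longrightarrow> (h \<cdot> g) \<cdot> f = h \<cdot> (g \<cdot> f)"

definition monic :: "('o, 'm) precategory \<Rightarrow> 'm \<Rightarrow> bool" where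
  "monic C m \<longleftrightarrow> m \<in> Ar C \<and>
    (\<forall>S. \<forall>u \<in> hom C S (Dom C m). \<forall>v \<in> hom C S (Dom C m).
      m \<cdot>\<^bsub>C\<^esub> u = m \<cdot>\<^bsub>C\<^esub> v \<longrightarrow> u = v)"


section \<open>Limits and coequalizers\<close>

definition terminal_object :: "('o, 'm) precategory \<Rightarrow> 'o \<Rightarrow> bool" where
  "terminal_object C T \<longleftrightarrow> T \<in> Ob C \<and> (\<forall>A \<in> Ob C. \<exists>!f. f \<in> hom C A T)"

definition initial_object :: "('o, 'm) precategory \<Rightarrow> 'o \<Rightarrow> bool" where
  "initial_object C I \<longleftrightarrow> I \<in> Ob C \<and> (\<forall>A \<in> Ob C. \<exists>!f. f \<in> hom C I A)"

definition is_product ::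
  "('o, 'm) precategory \<Rightarrow> 'o \<Rightarrow> 'o \<Rightarrow> 'o \<Rightarrow> 'm \<Rightarrow> 'm \<Rightarrow> bool" where
  "is_product C X Y P p q \<longleftrightarrow>
    X \<in> Ob C \<and> Y \<in> Ob C \<and> p \<in> hom C P X \<and> q \<in> hom C P Y \<and>
    (\<forall>S. \<forall>x \<in> hom C S X. \<forall>y \<in> hom C S Y.
      \<exists>!u. u \<in> hom C S P \<and> p \<cdot>\<^bsub>C\<^esub> u = x \<and> q \<cdot>\<^bsub>C\<^esub> u = y)"

text \<open>The induced morphism \<open>(x, y) : S \<rightarrow> P\<close>, where \<open>P\<close> is a product with projections \<open>p\<close>, \<open>q\<close>.\<close>

definition pairing :: "('o, 'm) precategory \<Rightarrow> 'm \<Rightarrow> 'm \<Rightarrow> 'm \<Rightarrow> 'm \<Rightarrow> 'm" where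
  "pairing C p q x y =
    (THE u. u \<in> hom C (Dom C x) (Dom C p) \<and> p \<cdot>\<^bsub>C\<^esub> u = x \<and> q \<cdot>\<^bsub>C\<^esub> u = y)"

definition is_pullback ::
  "('o, 'm) precategory \<Rightarrow> 'm \<Rightarrow> 'm \<Rightarrow> 'o \<Rightarrow> 'm \<Rightarrow> 'm \<Rightarrow> bool" where
  "is_pullback C f g P p q \<longleftrightarrow>
    f \<in> Ar C \<and> g \<in> Ar C \<and> Cod C f = Cod C g \<and>
    p \<in> hom C P (Dom C f) \<and> q \<in> hom C P (Dom C g) \<and> f \<cdot>\<^bsub>C\<^esub> p = g \<cdot>\<^bsub>C\<^esub> q \<and>
    (\<forall>S. \<forall>x \<in> hom C S (Dom C f). \<forall>y \<in> hom C S (Dom C g). f \<cdot>\<^bsub>C\<^esub> x = g \<cdot>\<^bsub>C\<^esub> y \<longrightarrow>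
      (\<exists>!u. u \<in> hom C S P \<and> p \<cdot>\<^bsub>C\<^esub> u = x \<and> q \<cdot>\<^bsub>C\<^esub> u = y))"

definition is_kernel_pair ::
  "('o, 'm) precategory \<Rightarrow> 'm \<Rightarrow> 'o \<Rightarrow> 'm \<Rightarrow> 'm \<Rightarrow> bool" where
  "is_kernel_pair C f K k1 k2 \<longleftrightarrow> is_pullback C f f K k1 k2"

definition is_coequalizer :: "('o, 'm) precategory \<Rightarrow> 'm \<Rightarrow> 'm \<Rightarrow> 'm \<Rightarrow> bool" where
  "is_coequalizer C f g e \<longleftrightarrow>
    f \<in> Ar C \<and> g \<in> Ar C \<and> Dom C f = Dom C g \<and> Cod C f = Cod C g \<and>
    e \<in> Ar C \<and> Dom C e = Cod C f \<and> e \<cdot>\<^bsub>C\<^esub> f = e \<cdot>\<^bsub>C\<^esub> g \<and>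
    (\<forall>Z. \<forall>h \<in> hom C (Cod C f) Z. h \<cdot>\<^bsub>C\<^esub> f = h \<cdot>\<^bsub>C\<^esub> g \<longrightarrow>
      (\<exists>!u. u \<in> hom C (Cod C e) Z \<and> u \<cdot>\<^bsub>C\<^esub> e = h))"

definition regular_epi :: "('o, 'm) precategory \<Rightarrow> 'm \<Rightarrow> bool" where
  "regular_epi C e \<longleftrightarrow> (\<exists>f g. is_coequalizer C f g e)"

definition has_finite_products :: "('o, 'm) precategory \<Rightarrow> bool" where
  "has_finite_products C \<longleftrightarrow>
    (\<exists>T. terminal_object C T) \<and>
    (\<forall>X \<in> Ob C. \<forall>Y \<in> Ob C. \<exists>P p q. is_product C X Y P p q)"

definition has_pullbacks :: "('o, 'm) precategory \<Rightarrow> bool" where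
  "has_pullbacks C \<longleftrightarrow>
    (\<forall>f \<in> Ar C. \<forall>g \<in> Ar C. Cod C f = Cod C g \<longrightarrow> (\<exists>P p q. is_pullback C f g P p q))"

definition finitely_complete :: "('o, 'm) precategory \<Rightarrow> bool" where
  "finitely_complete C \<longleftrightarrow> has_finite_products C \<and> has_pullbacks C"

text \<open>Regular categories in the sense of Barr: finite limits, coequalizers of kernel pairs, and
  pullback-stable regular epimorphisms.\<close>

definition regular_category :: "('o, 'm) precategory \<Rightarrow> bool" where
  "regular_category C \<longleftrightarrow> category C \<and> finitely_complete C \<and>
    (\<forall>f K k1 k2. is_kernel_pair C f K k1 k2 \<longrightarrow> (\<exists>e. is_coequalizer C k1 k2 e)) \<and>
    (\<forall>f g P p q. is_pullback C f g P p q \<and> regular_epi C g \<longrightarrow> regular_epi C p)"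


section \<open>Internal relations\<close>

text \<open>A relation from \<open>A\<close> to \<open>B\<close> is represented by a jointly monic span \<open>(r1, r2)\<close> on an object
  \<open>R\<close>; since \<open>R\<close> is the domain of both legs, it is not recorded separately.  Relations are
  subobjects, so they are compared up to isomorphism of spans (\<open>rel_eq\<close>).\<close>

definition is_relation ::
  "('o, 'm) precategory \<Rightarrow> 'o \<Rightarrow> 'o \<Rightarrow> 'm \<times> 'm \<Rightarrow> bool" where
  "is_relation C A B = (\<lambda>(r1, r2). \<exists>R. r1 \<in> hom C R A \<and> r2 \<in> hom C R B \<and>
    (\<forall>S. \<forall>u \<in> hom C S R. \<forall>v \<in> hom C S R.
      r1 \<cdot>\<^bsub>C\<^esub> u = r1 \<cdot>\<^bsub>C\<^esub> v \<and> r2 \<cdot>\<^bsub>C\<^esub> u = r2 \<cdot>\<^bsub>C\<^esub> v \<longrightarrow> u = v))"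

definition rel_le :: "('o, 'm) precategory \<Rightarrow> 'm \<times> 'm \<Rightarrow> 'm \<times> 'm \<Rightarrow> bool" where
  "rel_le C = (\<lambda>(r1, r2) (s1, s2).
    \<exists>h \<in> hom C (Dom C r1) (Dom C s1). s1 \<cdot>\<^bsub>C\<^esub> h = r1 \<and> s2 \<cdot>\<^bsub>C\<^esub> h = r2)"

definition rel_eq :: "('o, 'm) precategory \<Rightarrow> 'm \<times> 'm \<Rightarrow> 'm \<times> 'm \<Rightarrow> bool" where
  "rel_eq C r s \<longleftrightarrow> rel_le C r s \<and> rel_le C s r"

definition is_equivalence_relation ::
  "('o, 'm) precategory \<Rightarrow> 'o \<Rightarrow> 'm \<times> 'm \<Rightarrow> bool" where
  "is_equivalence_relation C A = (\<lambda>(r1, r2). is_relation C A A (r1, r2) \<and>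
    (\<exists>d \<in> hom C A (Dom C r1). r1 \<cdot>\<^bsub>C\<^esub> d = Ident C A \<and> r2 \<cdot>\<^bsub>C\<^esub> d = Ident C A) \<and>
    (\<exists>s \<in> hom C (Dom C r1) (Dom C r1). r1 \<cdot>\<^bsub>C\<^esub> s = r2 \<and> r2 \<cdot>\<^bsub>C\<^esub> s = r1) \<and>
    (\<forall>P p q. is_pullback C r2 r1 P p q \<longrightarrow>
      (\<exists>t \<in> hom C P (Dom C r1). r1 \<cdot>\<^bsub>C\<^esub> t = r1 \<cdot>\<^bsub>C\<^esub> p \<and> r2 \<cdot>\<^bsub>C\<^esub> t = r2 \<cdot>\<^bsub>C\<^esub> q)))"

text \<open>\<open>is_rel_comp C A D s r t\<close>: the relation \<open>t\<close> from \<open>A\<close> to \<open>D\<close> represents the composite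
  \<open>s \<circ> r\<close> (first \<open>r\<close>, then \<open>s\<close>), that is, the regular image in \<open>A \<times> D\<close> of the pullback of \<open>r2\<close>
  along \<open>s1\<close>.  In a regular category such a \<open>t\<close> always exists, and it is unique up to \<open>rel_eq\<close>.\<close>

definition is_rel_comp ::
  "('o, 'm) precategory \<Rightarrow> 'o \<Rightarrow> 'o \<Rightarrow> 'm \<times> 'm \<Rightarrow> 'm \<times> 'm \<Rightarrow> 'm \<times> 'm \<Rightarrow> bool" where
  "is_rel_comp C A D = (\<lambda>(s1, s2) (r1, r2) (t1, t2). is_relation C A D (t1, t2) \<and>
    (\<exists>P p q e. is_pullback C r2 s1 P p q \<and> e \<in> hom C P (Dom C t1) \<and> regular_epi C e \<and>
      t1 \<cdot>\<^bsub>C\<^esub> e = r1 \<cdot>\<^bsub>C\<^esub> p \<and> t2 \<cdot>\<^bsub>C\<^esub> e = s2 \<cdot>\<^bsub>C\<^esub> q))"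

definition product_projection :: "('o, 'm) precategory \<Rightarrow> 'o \<Rightarrow> 'o \<Rightarrow> 'm \<Rightarrow> bool" where
  "product_projection C A X p \<longleftrightarrow>
    (\<exists>Y q. is_product C X Y A p q \<or> is_product C Y X A q p)"

definition factor_permutable :: "('o, 'm) precategory \<Rightarrow> bool" where
  "factor_permutable C \<longleftrightarrow> regular_category C \<and>
    (\<forall>A E X p K k1 k2 t u.
      is_equivalence_relation C A E \<and> product_projection C A X p \<and>
      is_kernel_pair C p K k1 k2 \<and>
      is_rel_comp C A A (k1, k2) E t \<and> is_rel_comp C A A E (k1, k2) u \<longrightarrow> rel_eq C t u)"


section \<open>Pointed, centralic and strongly centralic categories\<close>

definition zero_object :: "('o, 'm) precategory \<Rightarrow> 'o \<Rightarrow> bool" where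
  "zero_object C Z \<longleftrightarrow> initial_object C Z \<and> terminal_object C Z"

definition pointed_category :: "('o, 'm) precategory \<Rightarrow> bool" where
  "pointed_category C \<longleftrightarrow> category C \<and> (\<exists>Z. zero_object C Z)"

definition zero_morphism :: "('o, 'm) precategory \<Rightarrow> 'o \<Rightarrow> 'o \<Rightarrow> 'm" where
  "zero_morphism C A B =
    (THE f. \<exists>Z. zero_object C Z \<and> (\<exists>u \<in> hom C A Z. \<exists>v \<in> hom C Z B. f = v \<cdot>\<^bsub>C\<^esub> u))"

text \<open>In the next two definitions \<open>P\<close> ranges over all representations of \<open>X \<times> Y\<close> (respectively
  \<open>X \<times> X\<close>), so no choice of products is involved.\<close>

definition centralic :: "('o, 'm) precategory \<Rightarrow> bool" where
  "centralic C \<longleftrightarrow> pointed_category C \<and> has_finite_products C \<and>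
    (\<forall>X Y P p q Z S. is_product C X Y P p q \<longrightarrow>
      (\<forall>f \<in> hom C P Z. \<forall>x \<in> hom C S X. \<forall>x' \<in> hom C S X. \<forall>y \<in> hom C S Y.
        f \<cdot>\<^bsub>C\<^esub> pairing C p q x (zero_morphism C S Y) =
          f \<cdot>\<^bsub>C\<^esub> pairing C p q x' (zero_morphism C S Y) \<longrightarrow>
        f \<cdot>\<^bsub>C\<^esub> pairing C p q x y = f \<cdot>\<^bsub>C\<^esub> pairing C p q x' y))"

definition condition_S :: "('o, 'm) precategory \<Rightarrow> bool" where
  "condition_S C \<longleftrightarrow>
    (\<forall>X P p q W Y m. is_product C X X P p q \<and> m \<in> hom C W Y \<and> monic C m \<longrightarrow>
      (\<forall>\<phi> \<in> hom C P Y. \<forall>f \<in> hom C X W.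
        \<phi> \<cdot>\<^bsub>C\<^esub> pairing C p q (Ident C X) (zero_morphism C X X) = m \<cdot>\<^bsub>C\<^esub> f \<and>
        m \<cdot>\<^bsub>C\<^esub> f = \<phi> \<cdot>\<^bsub>C\<^esub> pairing C p q (zero_morphism C X X) (Ident C X) \<longrightarrow>
        (\<exists>\<psi> \<in> hom C P W. m \<cdot>\<^bsub>C\<^esub> \<psi> = \<phi>)))"

definition strongly_centralic :: "('o, 'm) precategory \<Rightarrow> bool" where
  "strongly_centralic C \<longleftrightarrow> pointed_category C \<and> centralic C \<and> condition_S C"

end

theory Submission
  imports Defs
begin

text \<open>
  In terms of elements, factor permutability says: if \<open>s\<close> and \<open>t\<close> have the same image under a product
  projection \<open>p\<close>, and \<open>g t = g r\<close>, then some \<open>w\<close> has \<open>g w = g s\<close> and \<open>p w = p r\<close>. Both halves of the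
  theorem apply this to the kernel pair of a suitable \<open>g\<close> and one well-chosen chain \<open>s, t, r\<close>.

  \<^item> Centrality. Suppose \<open>f(x, 0) = f(x', 0)\<close>. On \<open>(X \<times> X) \<times> Y\<close> take
    \<open>g(a, b, c) = (f(a, c), f(b, c))\<close> and the projection onto \<open>X \<times> X\<close>. The chain
    \<open>(x, x', y), (x, x', 0), (x, x, 0)\<close> yields some \<open>w = (x, x, c)\<close> with
    \<open>f(x, y) = f(x, c) = f(x', y)\<close>. Doubling \<open>X\<close> is the point: in \<open>X \<times> Y\<close> itself permutability only
    gives \<open>f(x, y) = f(x', c)\<close> for an unknown \<open>c\<close>, whereas on the diagonal of \<open>X \<times> X\<close> the unknown
    coordinate is the same on both sides and is eliminated.
  \<^item> Condition (S). Suppose \<open>\<phi>(x, 0) = m f(x) = \<phi>(0, x)\<close>. On \<open>X \<times> X\<close> take \<open>g = \<phi>\<close> and the second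
    projection. The chain \<open>(a, b), (0, b), (b, 0)\<close> yields some \<open>w = (c, 0)\<close>, and
    \<open>\<phi>(a, b) = \<phi>(c, 0) = m f(c)\<close> lies in the subobject \<open>m\<close>.

  Elements are morphisms \<open>S \<rightarrow> A\<close>, and the element \<open>w\<close> exists only after pulling back along a regular
  epimorphism \<open>S' \<rightarrow> S\<close>, because composites of relations are images
  (\<open>factor_permutability_on_elements\<close>). The equation of the first part descends along such a cover
  because regular epimorphisms are epic (\<open>regular_epi_cancel\<close>), and the factorization of the second
  part because they lift against monomorphisms (\<open>regular_epi_lifts_against_monic\<close>).

  Factor permutability compares given composites of relations, so using it requires that the composites
  exist. This rests on the factorization of every morphism of a regular category into a regular
  epimorphism and a monomorphism (\<open>image_factorization\<close>).
\<close>

context category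
begin

lemma hom_Ob: "f \<in> hom C A B \<Longrightarrow> A \<in> Ob C \<and> B \<in> Ob C"
  using Dom_in_Ob Cod_in_Ob by (auto simp: hom_def)

section \<open>Universal properties as elimination rules\<close>

lemma pullbackE:
  assumes "is_pullback C f g P p q" and "f \<in> hom C A D" and "g \<in> hom C B D"
  obtains "p \<in> hom C P A" and "q \<in> hom C P B" and "f \<cdot> p = g \<cdot> q"
    and "\<And>S x y. \<lbrakk>x \<in> hom C S A; y \<in> hom C S B; f \<cdot> x = g \<cdot> y\<rbrakk>
      \<Longrightarrow> \<exists>u \<in> hom C S P. p \<cdot> u = x \<and> q \<cdot> u = y"
    and "\<And>S u v. \<lbrakk>u \<in> hom C S P; v \<in> hom C S P; p \<cdot> u = p \<cdot> v; q \<cdot> u = q \<cdot> v\<rbrakk> \<Longrightarrow> u = v"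
proof
  have D: "Dom C f = A" "Dom C g = B"
    using assms(2,3) by (simp_all add: hom_def)
  note pb = assms(1)[unfolded is_pullback_def D]
  show p: "p \<in> hom C P A" and q: "q \<in> hom C P B" and eq: "f \<cdot> p = g \<cdot> q"
    using pb by blast+
  show "\<exists>u \<in> hom C S P. p \<cdot> u = x \<and> q \<cdot> u = y"
    if "x \<in> hom C S A" "y \<in> hom C S B" "f \<cdot> x = g \<cdot> y" for S x y
    using pb that by blast
  show "u = v" if uv: "u \<in> hom C S P" "v \<in> hom C S P" "p \<cdot> u = p \<cdot> v" "q \<cdot> u = q \<cdot> v" for S u v
  proof -
    have "f \<cdot> (p \<cdot> u) = g \<cdot> (q \<cdot> u)"
      using Comp_assoc[OF uv(1) p assms(2)] Comp_assoc[OF uv(1) q assms(3)] eq by simp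
    then have "\<exists>!w. w \<in> hom C S P \<and> p \<cdot> w = p \<cdot> u \<and> q \<cdot> w = q \<cdot> u"
      using pb Comp_in_hom[OF uv(1) p] Comp_in_hom[OF uv(1) q] by blast
    then show ?thesis
      using uv by metis
  qed
qed

lemma productE:
  assumes "is_product C X Y P p q"
  obtains "p \<in> hom C P X" and "q \<in> hom C P Y"
    and "\<And>S x y. \<lbrakk>x \<in> hom C S X; y \<in> hom C S Y\<rbrakk> \<Longrightarrow> \<exists>u \<in> hom C S P. p \<cdot> u = x \<and> q \<cdot> u = y"
    and "\<And>S u v. \<lbrakk>u \<in> hom C S P; v \<in> hom C S P; p \<cdot> u = p \<cdot> v; q \<cdot> u = q \<cdot> v\<rbrakk> \<Longrightarrow> u = v"
proof
  note pr = assms[unfolded is_product_def]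
  show p: "p \<in> hom C P X" and q: "q \<in> hom C P Y"
    using pr by blast+
  show "\<exists>u \<in> hom C S P. p \<cdot> u = x \<and> q \<cdot> u = y"
    if "x \<in> hom C S X" "y \<in> hom C S Y" for S x y
    using pr that by blast
  show "u = v" if uv: "u \<in> hom C S P" "v \<in> hom C S P" "p \<cdot> u = p \<cdot> v" "q \<cdot> u = q \<cdot> v" for S u v
  proof -
    have "\<exists>!w. w \<in> hom C S P \<and> p \<cdot> w = p \<cdot> u \<and> q \<cdot> w = q \<cdot> u"
      using pr Comp_in_hom[OF uv(1) p] Comp_in_hom[OF uv(1) q] by blast
    then show ?thesis
      using uv by metis
  qed
qed

lemma pairing:
  assumes "is_product C X Y P p q" and "x \<in> hom C S X" and "y \<in> hom C S Y"
  shows "pairing C p q x y \<in> hom C S P"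
    and "p \<cdot> pairing C p q x y = x" and "q \<cdot> pairing C p q x y = y"
proof -
  have D: "Dom C x = S" "Dom C p = P"
    using assms(1,2) by (auto simp: hom_def is_product_def)
  have "\<exists>!u. u \<in> hom C S P \<and> p \<cdot> u = x \<and> q \<cdot> u = y"
    using assms unfolding is_product_def by blast
  from theI'[OF this]
  show "pairing C p q x y \<in> hom C S P"
    and "p \<cdot> pairing C p q x y = x" and "q \<cdot> pairing C p q x y = y"
    unfolding pairing_def D by blast+
qed

section \<open>Regular epimorphisms, images and composites of relations\<close>

lemma regular_epi_cancel:
  assumes "regular_epi C e" and e: "e \<in> hom C A B"
    and u: "u \<in> hom C B D" and v: "v \<in> hom C B D" and eq: "u \<cdot> e = v \<cdot> e"
  shows "u = v"
proof -
  obtain f g where c: "is_coequalizer C f g e"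
    using assms(1) unfolding regular_epi_def by blast
  have DC: "Dom C e = A" "Cod C e = B" "Cod C f = A"
    using c e by (auto simp: is_coequalizer_def hom_def)
  have f: "f \<in> hom C (Dom C f) A" and g: "g \<in> hom C (Dom C f) A"
    using c DC by (auto simp: is_coequalizer_def hom_def)
  have "(u \<cdot> e) \<cdot> f = (u \<cdot> e) \<cdot> g"
    using Comp_assoc[OF f e u] Comp_assoc[OF g e u] c by (simp add: is_coequalizer_def)
  then have "\<exists>!w. w \<in> hom C B D \<and> w \<cdot> e = u \<cdot> e"
    using c Comp_in_hom[OF e u] unfolding is_coequalizer_def DC by blast
  then show ?thesis
    using u v eq by metis
qed

lemma regular_epi_lifts_against_monic:
  assumes "regular_epi C e" and e: "e \<in> hom C A B"
    and "monic C m" and m: "m \<in> hom C W Y"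
    and h: "h \<in> hom C B Y" and k: "k \<in> hom C A W" and eq: "m \<cdot> k = h \<cdot> e"
  shows "\<exists>d \<in> hom C B W. m \<cdot> d = h"
proof -
  obtain f g where c: "is_coequalizer C f g e"
    using assms(1) unfolding regular_epi_def by blast
  have DC: "Dom C e = A" "Cod C e = B" "Cod C f = A" "Dom C m = W"
    using c e m by (auto simp: is_coequalizer_def hom_def)
  have f: "f \<in> hom C (Dom C f) A" and g: "g \<in> hom C (Dom C f) A"
    using c DC by (auto simp: is_coequalizer_def hom_def)
  have "m \<cdot> (k \<cdot> f) = h \<cdot> (e \<cdot> f)"
    using Comp_assoc[OF f k m] Comp_assoc[OF f e h] eq by simp
  also have "\<dots> = h \<cdot> (e \<cdot> g)"
    using c by (simp add: is_coequalizer_def)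
  also have "\<dots> = m \<cdot> (k \<cdot> g)"
    using Comp_assoc[OF g k m] Comp_assoc[OF g e h] eq by simp
  finally have "k \<cdot> f = k \<cdot> g"
    using assms(3) Comp_in_hom[OF f k] Comp_in_hom[OF g k] unfolding monic_def DC by blast
  then obtain d where d: "d \<in> hom C B W" "d \<cdot> e = k"
    using c k unfolding is_coequalizer_def DC by blast
  have "(m \<cdot> d) \<cdot> e = h \<cdot> e"
    using Comp_assoc[OF e d(1) m] d(2) eq by simp
  then have "m \<cdot> d = h"
    using regular_epi_cancel[OF assms(1) e Comp_in_hom[OF d(1) m] h] by blast
  then show ?thesis
    using d(1) by blast
qed

text \<open>In terms of generalized elements the kernel pair is the relation \<open>g x = g y\<close>, so it inherits
  reflexivity, symmetry and transitivity from equality.\<close>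

lemma kernel_pair_is_equivalence_relation:
  assumes "is_kernel_pair C g K k1 k2" and g: "g \<in> hom C A Z"
  shows "is_equivalence_relation C A (k1, k2)"
proof -
  from assms(1)[unfolded is_kernel_pair_def] g g
  show ?thesis
  proof (rule pullbackE)
    assume k1: "k1 \<in> hom C K A" and k2: "k2 \<in> hom C K A" and eq: "g \<cdot> k1 = g \<cdot> k2"
      and ex: "\<And>S x y. \<lbrakk>x \<in> hom C S A; y \<in> hom C S A; g \<cdot> x = g \<cdot> y\<rbrakk>
        \<Longrightarrow> \<exists>u \<in> hom C S K. k1 \<cdot> u = x \<and> k2 \<cdot> u = y"
      and un: "\<And>S u v. \<lbrakk>u \<in> hom C S K; v \<in> hom C S K; k1 \<cdot> u = k1 \<cdot> v; k2 \<cdot> u = k2 \<cdot> v\<rbrakk> \<Longrightarrow> u = v"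
    have D: "Dom C k1 = K" and A: "A \<in> Ob C"
      using k1 g hom_Ob by (auto simp: hom_def)
    have "\<exists>t \<in> hom C P K. k1 \<cdot> t = k1 \<cdot> a \<and> k2 \<cdot> t = k2 \<cdot> b"
      if pb: "is_pullback C k2 k1 P a b" for P a b
    proof -
      have a: "a \<in> hom C P K" and b: "b \<in> hom C P K" and ab: "k2 \<cdot> a = k1 \<cdot> b"
        using pb k1 k2 by (auto simp: is_pullback_def hom_def)
      have "g \<cdot> (k1 \<cdot> a) = g \<cdot> (k2 \<cdot> a)"
        using Comp_assoc[OF a k1 g] Comp_assoc[OF a k2 g] eq by simp
      also have "\<dots> = g \<cdot> (k2 \<cdot> b)"
        using Comp_assoc[OF b k1 g] Comp_assoc[OF b k2 g] eq ab by simp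
      finally show ?thesis
        using ex[OF Comp_in_hom[OF a k1] Comp_in_hom[OF b k2]] by blast
    qed
    moreover have "is_relation C A A (k1, k2)"
      unfolding is_relation_def using k1 k2 un by blast
    moreover have "\<exists>d \<in> hom C A K. k1 \<cdot> d = Ident C A \<and> k2 \<cdot> d = Ident C A"
      using ex Ident_in_hom[OF A] by blast
    moreover have "\<exists>s \<in> hom C K K. k1 \<cdot> s = k2 \<and> k2 \<cdot> s = k1"
      using ex[OF k2 k1] eq by simp
    ultimately show ?thesis
      unfolding is_equivalence_relation_def split D by blast
  qed
qed

lemma pullback_exists:
  assumes "regular_category C" and f: "f \<in> hom C A D" and g: "g \<in> hom C B D"
  obtains P p q where "is_pullback C f g P p q" and "p \<in> hom C P A" and "q \<in> hom C P B"
    and "f \<cdot> p = g \<cdot> q"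
proof -
  have D: "Dom C f = A" "Dom C g = B" "f \<in> Ar C" "g \<in> Ar C" "Cod C f = Cod C g"
    using f g by (simp_all add: hom_def)
  have "has_pullbacks C"
    using assms(1) by (simp add: regular_category_def finitely_complete_def)
  then obtain P p q where pb: "is_pullback C f g P p q"
    using D unfolding has_pullbacks_def by blast
  from that[OF pb] pb show ?thesis
    unfolding is_pullback_def D by blast
qed

lemma product_exists:
  assumes "regular_category C" and "X \<in> Ob C" and "Y \<in> Ob C"
  obtains P p q where "is_product C X Y P p q"
  using assms unfolding regular_category_def finitely_complete_def has_finite_products_def
  by blast

text \<open>A regular epimorphism is locally surjective: an element \<open>z\<close> of its codomain has a preimage on a
  cover of its domain of definition.\<close>

lemma regular_epi_pullback_cover:
  assumes reg: "regular_category C" and "regular_epi C e"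
    and e: "e \<in> hom C P T" and z: "z \<in> hom C S T"
  obtains S' c y where "c \<in> hom C S' S" and "regular_epi C c" and "y \<in> hom C S' P"
    and "e \<cdot> y = z \<cdot> c"
proof -
  obtain S' c y where pb: "is_pullback C z e S' c y"
    and cy: "c \<in> hom C S' S" "y \<in> hom C S' P" "z \<cdot> c = e \<cdot> y"
    using pullback_exists[OF reg z e] by blast
  have "regular_epi C c"
    using reg pb assms(2) unfolding regular_category_def by blast
  then show ?thesis
    using that cy by simp
qed

text \<open>The image is the coequalizer \<open>e\<close> of the kernel pair of \<open>f\<close>. The comparison \<open>m\<close> is monic because
  elements \<open>u\<close>, \<open>v\<close> of the image with \<open>m u = m v\<close> have, on a common cover, preimages under \<open>e\<close> that \<open>f\<close>
  identifies. Such preimages form an element of the kernel pair, so \<open>e\<close> identifies them as well.\<close>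

lemma image_factorization:
  assumes reg: "regular_category C" and f: "f \<in> hom C P B"
  obtains T e m where "e \<in> hom C P T" and "regular_epi C e"
    and "m \<in> hom C T B" and "monic C m" and "m \<cdot> e = f"
proof -
  obtain K k1 k2 where pb: "is_pullback C f f K k1 k2"
    using pullback_exists[OF reg f f] by blast
  then obtain e where ce: "is_coequalizer C k1 k2 e"
    using reg unfolding regular_category_def is_kernel_pair_def by blast
  define T where "T = Cod C e"
  from pb f f show thesis
  proof (rule pullbackE)
    assume k1: "k1 \<in> hom C K P" and k2: "k2 \<in> hom C K P" and eq: "f \<cdot> k1 = f \<cdot> k2"
      and ex: "\<And>S x y. \<lbrakk>x \<in> hom C S P; y \<in> hom C S P; f \<cdot> x = f \<cdot> y\<rbrakk>
        \<Longrightarrow> \<exists>u \<in> hom C S K. k1 \<cdot> u = x \<and> k2 \<cdot> u = y"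
    have CK: "Cod C k1 = P"
      using k1 by (simp add: hom_def)
    have e: "e \<in> hom C P T"
      using ce CK by (auto simp: is_coequalizer_def hom_def T_def)
    have re: "regular_epi C e"
      using ce unfolding regular_epi_def by blast
    obtain m where m: "m \<in> hom C T B" and me: "m \<cdot> e = f"
      using ce f eq unfolding is_coequalizer_def CK T_def by blast
    have "u = v" if u: "u \<in> hom C S T" and v: "v \<in> hom C S T" and uv: "m \<cdot> u = m \<cdot> v" for S u v
    proof -
      obtain S1 c x where c: "c \<in> hom C S1 S" "regular_epi C c"
        and x: "x \<in> hom C S1 P" "e \<cdot> x = u \<cdot> c"
        using regular_epi_pullback_cover[OF reg re e u] by blast
      have vc: "v \<cdot> c \<in> hom C S1 T"
        using Comp_in_hom[OF c(1) v] .
      obtain S2 d y where d: "d \<in> hom C S2 S1" "regular_epi C d"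
        and y: "y \<in> hom C S2 P" "e \<cdot> y = (v \<cdot> c) \<cdot> d"
        using regular_epi_pullback_cover[OF reg re e vc] by blast
      have xd: "x \<cdot> d \<in> hom C S2 P"
        using Comp_in_hom[OF d(1) x(1)] .
      have exd: "e \<cdot> (x \<cdot> d) = (u \<cdot> c) \<cdot> d"
        using Comp_assoc[OF d(1) x(1) e] x(2) by simp
      have cd: "c \<cdot> d \<in> hom C S2 S"
        using Comp_in_hom[OF d(1) c(1)] .
      have "f \<cdot> (x \<cdot> d) = m \<cdot> (u \<cdot> (c \<cdot> d))"
        using Comp_assoc[OF xd e m] me exd Comp_assoc[OF d(1) c(1) u] by simp
      also have "\<dots> = m \<cdot> (v \<cdot> (c \<cdot> d))"
        using Comp_assoc[OF cd u m] Comp_assoc[OF cd v m] uv by simp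
      also have "\<dots> = f \<cdot> y"
        using Comp_assoc[OF y(1) e m] me y(2) Comp_assoc[OF d(1) c(1) v] by simp
      finally obtain w where w: "w \<in> hom C S2 K" "k1 \<cdot> w = x \<cdot> d" "k2 \<cdot> w = y"
        using ex[OF xd y(1)] by blast
      have "e \<cdot> k1 = e \<cdot> k2"
        using ce by (simp add: is_coequalizer_def)
      then have "e \<cdot> (x \<cdot> d) = e \<cdot> y"
        using Comp_assoc[OF w(1) k1 e] Comp_assoc[OF w(1) k2 e] w by simp
      then have "(u \<cdot> c) \<cdot> d = (v \<cdot> c) \<cdot> d"
        using exd y(2) by simp
      then have "u \<cdot> c = v \<cdot> c"
        using regular_epi_cancel[OF d(2,1) Comp_in_hom[OF c(1) u] vc] by blast
      then show "u = v"
        using regular_epi_cancel[OF c(2,1) u v] by blast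
    qed
    then have "monic C m"
      using m by (auto simp: monic_def hom_def)
    then show thesis
      using that e re m me by blast
  qed
qed

lemma rel_comp_exists:
  assumes reg: "regular_category C"
    and r1: "r1 \<in> hom C R A" and r2: "r2 \<in> hom C R B"
    and s1: "s1 \<in> hom C U B" and s2: "s2 \<in> hom C U D"
  obtains t1 t2 where "is_rel_comp C A D (s1, s2) (r1, r2) (t1, t2)"
proof -
  obtain P p q where pb: "is_pullback C r2 s1 P p q"
    and p: "p \<in> hom C P R" and q: "q \<in> hom C P U"
    using pullback_exists[OF reg r2 s1] by blast
  obtain Q a b where prod: "is_product C A D Q a b"
    using product_exists[OF reg] hom_Ob[OF r1] hom_Ob[OF s2] by blast
  from prod show thesis
  proof (rule productE)
    assume a: "a \<in> hom C Q A" and b: "b \<in> hom C Q D"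
      and ex: "\<And>S x y. \<lbrakk>x \<in> hom C S A; y \<in> hom C S D\<rbrakk> \<Longrightarrow> \<exists>u \<in> hom C S Q. a \<cdot> u = x \<and> b \<cdot> u = y"
      and un: "\<And>S u v. \<lbrakk>u \<in> hom C S Q; v \<in> hom C S Q; a \<cdot> u = a \<cdot> v; b \<cdot> u = b \<cdot> v\<rbrakk> \<Longrightarrow> u = v"
    obtain f where f: "f \<in> hom C P Q" "a \<cdot> f = r1 \<cdot> p" "b \<cdot> f = s2 \<cdot> q"
      using ex[OF Comp_in_hom[OF p r1] Comp_in_hom[OF q s2]] by blast
    obtain T e m where e: "e \<in> hom C P T" "regular_epi C e"
      and m: "m \<in> hom C T Q" "monic C m" and me: "m \<cdot> e = f"
      using image_factorization[OF reg f(1)] by blast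
    have am: "a \<cdot> m \<in> hom C T A" and bm: "b \<cdot> m \<in> hom C T D"
      using Comp_in_hom[OF m(1) a] Comp_in_hom[OF m(1) b] .
    have DT: "Dom C (a \<cdot> m) = T" "Dom C m = T"
      using am m(1) by (simp_all add: hom_def)
    have "u = v" if u: "u \<in> hom C S T" and v: "v \<in> hom C S T"
      and eqs: "(a \<cdot> m) \<cdot> u = (a \<cdot> m) \<cdot> v" "(b \<cdot> m) \<cdot> u = (b \<cdot> m) \<cdot> v" for S u v
    proof -
      have "m \<cdot> u = m \<cdot> v"
        using un[OF Comp_in_hom[OF u m(1)] Comp_in_hom[OF v m(1)]] eqs
          Comp_assoc[OF u m(1) a] Comp_assoc[OF v m(1) a]
          Comp_assoc[OF u m(1) b] Comp_assoc[OF v m(1) b] by simp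
      then show ?thesis
        using m(2) u v unfolding monic_def DT by blast
    qed
    then have "is_relation C A D (a \<cdot> m, b \<cdot> m)"
      unfolding is_relation_def using am bm by blast
    moreover have "(a \<cdot> m) \<cdot> e = r1 \<cdot> p" "(b \<cdot> m) \<cdot> e = s2 \<cdot> q"
      using Comp_assoc[OF e(1) m(1) a] Comp_assoc[OF e(1) m(1) b] me f by simp_all
    ultimately have "is_rel_comp C A D (s1, s2) (r1, r2) (a \<cdot> m, b \<cdot> m)"
      unfolding is_rel_comp_def using pb e DT(1) by auto
    then show thesis
      by (rule that)
  qed
qed

section \<open>Permuting a product projection past a kernel pair\<close>

text \<open>The chain \<open>s, t, r\<close> exhibits \<open>(s, r)\<close> as an element of \<open>Eq(g) \<circ> Eq(p)\<close>, hence of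
  \<open>Eq(p) \<circ> Eq(g)\<close>, and \<open>w\<close> is the new intermediate point. The regular epimorphism \<open>c\<close> is the price for
  reading off an intermediate point from an image.\<close>

lemma factor_permutability_on_elements:
  assumes fp: "factor_permutable C" and proj: "product_projection C A X p"
    and p: "p \<in> hom C A X" and g: "g \<in> hom C A Z"
    and s: "s \<in> hom C S A" and t: "t \<in> hom C S A" and r: "r \<in> hom C S A"
    and st: "p \<cdot> s = p \<cdot> t" and tr: "g \<cdot> t = g \<cdot> r"
  obtains S' c w where "c \<in> hom C S' S" and "regular_epi C c" and "w \<in> hom C S' A"
    and "g \<cdot> w = g \<cdot> (s \<cdot> c)" and "p \<cdot> w = p \<cdot> (r \<cdot> c)"
proof -
  have reg: "regular_category C"
    using fp by (simp add: factor_permutable_def)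
  obtain K k1 k2 where kp: "is_pullback C p p K k1 k2"
    and k: "k1 \<in> hom C K A" "k2 \<in> hom C K A" "p \<cdot> k1 = p \<cdot> k2"
    using pullback_exists[OF reg p p] by blast
  obtain L l1 l2 where lg: "is_pullback C g g L l1 l2"
    and l: "l1 \<in> hom C L A" "l2 \<in> hom C L A" "g \<cdot> l1 = g \<cdot> l2"
    using pullback_exists[OF reg g g] by blast
  obtain t1 t2 where T: "is_rel_comp C A A (k1, k2) (l1, l2) (t1, t2)"
    using rel_comp_exists[OF reg l(1,2) k(1,2)] by blast
  obtain u1 u2 where U: "is_rel_comp C A A (l1, l2) (k1, k2) (u1, u2)"
    using rel_comp_exists[OF reg k(1,2) l(1,2)] by blast
  have "rel_eq C (t1, t2) (u1, u2)"
    using fp kernel_pair_is_equivalence_relation[OF _ g] lg kp proj T U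
    unfolding factor_permutable_def is_kernel_pair_def by blast
  then obtain h where h: "h \<in> hom C (Dom C u1) (Dom C t1)" "t1 \<cdot> h = u1" "t2 \<cdot> h = u2"
    by (auto simp: rel_eq_def rel_le_def)
  obtain P a b e where P: "is_pullback C k2 l1 P a b" "e \<in> hom C P (Dom C u1)"
    "u1 \<cdot> e = k1 \<cdot> a" "u2 \<cdot> e = l2 \<cdot> b"
    and urel: "is_relation C A A (u1, u2)"
    using U unfolding is_rel_comp_def by auto
  have u: "u1 \<in> hom C (Dom C u1) A" "u2 \<in> hom C (Dom C u1) A"
    using urel by (auto simp: is_relation_def hom_def)
  obtain Q a' b' e' where Q: "is_pullback C l2 k1 Q a' b'" "e' \<in> hom C Q (Dom C t1)"
    "regular_epi C e'" "t1 \<cdot> e' = l1 \<cdot> a'" "t2 \<cdot> e' = k2 \<cdot> b'"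
    and trel: "is_relation C A A (t1, t2)"
    using T unfolding is_rel_comp_def by auto
  have t12: "t1 \<in> hom C (Dom C t1) A" "t2 \<in> hom C (Dom C t1) A"
    using trel by (auto simp: is_relation_def hom_def)
  have ab: "a \<in> hom C P K" "b \<in> hom C P L"
    using P(1) k l by (auto simp: is_pullback_def hom_def)
  have ab': "a' \<in> hom C Q L" "b' \<in> hom C Q K" "l2 \<cdot> a' = k1 \<cdot> b'"
    using Q(1) k l by (auto simp: is_pullback_def hom_def)
  \<comment> \<open>The element \<open>(s, r)\<close> of \<open>Eq(g) \<circ> Eq(p)\<close>, with \<open>t\<close> as its intermediate point.\<close>
  obtain x where x: "x \<in> hom C S K" "k1 \<cdot> x = s" "k2 \<cdot> x = t"
    using kp p p by (rule pullbackE) (use s t st in blast)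
  obtain y where y: "y \<in> hom C S L" "l1 \<cdot> y = t" "l2 \<cdot> y = r"
    using lg g g by (rule pullbackE) (use t r tr in blast)
  have "k2 \<cdot> x = l1 \<cdot> y"
    using x y by simp
  then obtain v where v: "v \<in> hom C S P" "a \<cdot> v = x" "b \<cdot> v = y"
    using P(1) k(2) l(1) by (elim pullbackE) (use x(1) y(1) in blast)+
  have ev: "e \<cdot> v \<in> hom C S (Dom C u1)"
    using Comp_in_hom[OF v(1) P(2)] .
  define z where "z = h \<cdot> (e \<cdot> v)"
  have z: "z \<in> hom C S (Dom C t1)"
    unfolding z_def using Comp_in_hom[OF ev h(1)] .
  have t1z: "t1 \<cdot> z = s"
    unfolding z_def
    using Comp_assoc[OF ev h(1) t12(1)] h Comp_assoc[OF v(1) P(2) u(1)] P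
      Comp_assoc[OF v(1) ab(1) k(1)] v x by simp
  have t2z: "t2 \<cdot> z = r"
    unfolding z_def
    using Comp_assoc[OF ev h(1) t12(2)] h Comp_assoc[OF v(1) P(2) u(2)] P
      Comp_assoc[OF v(1) ab(2) l(2)] v y by simp
  \<comment> \<open>Seen in \<open>Eq(p) \<circ> Eq(g)\<close>, the pair \<open>(s, r)\<close> has an intermediate point only on a cover.\<close>
  obtain S' c w0 where c: "c \<in> hom C S' S" "regular_epi C c"
    and w0: "w0 \<in> hom C S' Q" "e' \<cdot> w0 = z \<cdot> c"
    using regular_epi_pullback_cover[OF reg Q(3,2) z] by blast
  define w where "w = k1 \<cdot> (b' \<cdot> w0)"
  have bw: "b' \<cdot> w0 \<in> hom C S' K" and aw: "a' \<cdot> w0 \<in> hom C S' L"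
    using Comp_in_hom[OF w0(1) ab'(2)] Comp_in_hom[OF w0(1) ab'(1)] .
  have w: "w \<in> hom C S' A"
    unfolding w_def using Comp_in_hom[OF bw k(1)] .
  have w2: "w = l2 \<cdot> (a' \<cdot> w0)"
    unfolding w_def
    using Comp_assoc[OF w0(1) ab'(2) k(1)] Comp_assoc[OF w0(1) ab'(1) l(2)] ab'(3) by simp
  have sc: "s \<cdot> c = l1 \<cdot> (a' \<cdot> w0)"
    using Comp_assoc[OF c(1) z t12(1)] t1z w0 Comp_assoc[OF w0(1) Q(2) t12(1)] Q(4)
      Comp_assoc[OF w0(1) ab'(1) l(1)] by simp
  have rc: "r \<cdot> c = k2 \<cdot> (b' \<cdot> w0)"
    using Comp_assoc[OF c(1) z t12(2)] t2z w0 Comp_assoc[OF w0(1) Q(2) t12(2)] Q(5)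
      Comp_assoc[OF w0(1) ab'(2) k(2)] by simp
  have "g \<cdot> w = g \<cdot> (s \<cdot> c)"
    unfolding w2 sc using Comp_assoc[OF aw l(1) g] Comp_assoc[OF aw l(2) g] l(3) by simp
  moreover have "p \<cdot> w = p \<cdot> (r \<cdot> c)"
    unfolding w_def rc using Comp_assoc[OF bw k(1) p] Comp_assoc[OF bw k(2) p] k(3) by simp
  ultimately show thesis
    using that c w by blast
qed

section \<open>Zero morphisms\<close>

text \<open>Any two zero objects are connected by a morphism, which is compatible with all morphisms into and
  out of them. Hence the factorization may use any one of them.\<close>

lemma zero_morphism_factors:
  assumes zo: "zero_object C Z" and u: "u \<in> hom C A Z" and v: "v \<in> hom C Z B"
  shows "zero_morphism C A B = v \<cdot> u"
  unfolding zero_morphism_def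
proof (rule the_equality)
  show "\<exists>Z. zero_object C Z \<and> (\<exists>u' \<in> hom C A Z. \<exists>v' \<in> hom C Z B. v \<cdot> u = v' \<cdot> u')"
    using assms by blast
next
  fix f
  assume "\<exists>Z. zero_object C Z \<and> (\<exists>u \<in> hom C A Z. \<exists>v \<in> hom C Z B. f = v \<cdot> u)"
  then obtain Z' u' v' where Z': "zero_object C Z'"
    and u': "u' \<in> hom C A Z'" and v': "v' \<in> hom C Z' B" and f: "f = v' \<cdot> u'"
    by blast
  have "Z \<in> Ob C"
    using hom_Ob[OF v] by simp
  then obtain j where j: "j \<in> hom C Z Z'"
    using Z' unfolding zero_object_def terminal_object_def by blast
  have AB: "A \<in> Ob C" "B \<in> Ob C"
    using hom_Ob[OF u] hom_Ob[OF v] by simp_all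
  have "j \<cdot> u = u'"
    using Z' AB u' Comp_in_hom[OF u j]
    unfolding zero_object_def terminal_object_def by blast
  moreover have "v' \<cdot> j = v"
    using zo AB v Comp_in_hom[OF j v']
    unfolding zero_object_def initial_object_def by blast
  ultimately show "f = v \<cdot> u"
    using f Comp_assoc[OF u j v'] by simp
qed

lemma zero_factorization_exists:
  assumes "pointed_category C" and "A \<in> Ob C" and "B \<in> Ob C"
  obtains Z u v where "zero_object C Z" and "u \<in> hom C A Z" and "v \<in> hom C Z B"
  using assms unfolding pointed_category_def zero_object_def initial_object_def
    terminal_object_def by blast

lemma zero_morphism_in_hom:
  assumes "pointed_category C" and "A \<in> Ob C" and "B \<in> Ob C"
  shows "zero_morphism C A B \<in> hom C A B"
proof -
  obtain Z u v where "zero_object C Z" "u \<in> hom C A Z" "v \<in> hom C Z B"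
    using zero_factorization_exists[OF assms] by blast
  then show ?thesis
    using zero_morphism_factors Comp_in_hom by metis
qed

lemma zero_morphism_comp:
  assumes "pointed_category C" and h: "h \<in> hom C S A" and "B \<in> Ob C"
  shows "zero_morphism C A B \<cdot> h = zero_morphism C S B"
proof -
  have A: "A \<in> Ob C"
    using hom_Ob[OF h] by simp
  obtain Z u v where Z: "zero_object C Z" and u: "u \<in> hom C A Z" and v: "v \<in> hom C Z B"
    using zero_factorization_exists[OF assms(1) A assms(3)] by blast
  show ?thesis
    using zero_morphism_factors[OF Z u v] zero_morphism_factors[OF Z Comp_in_hom[OF h u] v]
      Comp_assoc[OF h u v] by simp
qed

section \<open>Centrality and condition (S)\<close>

text \<open>A shifting property that is slightly stronger than centrality: an arbitrary \<open>n\<close> takes the place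
  of the zero morphism.\<close>

lemma factor_permutable_shift:
  assumes fp: "factor_permutable C" and prod: "is_product C X Y P p q"
    and f: "f \<in> hom C P Z"
    and x: "x \<in> hom C S X" and x': "x' \<in> hom C S X"
    and y: "y \<in> hom C S Y" and n: "n \<in> hom C S Y"
    and eq: "f \<cdot> pairing C p q x n = f \<cdot> pairing C p q x' n"
  shows "f \<cdot> pairing C p q x y = f \<cdot> pairing C p q x' y"
proof -
  have reg: "regular_category C"
    using fp by (simp add: factor_permutable_def)
  have obs: "X \<in> Ob C" "Y \<in> Ob C" "Z \<in> Ob C"
    using hom_Ob[OF x] hom_Ob[OF y] hom_Ob[OF f] by simp_all
  obtain XX a b where XX: "is_product C X X XX a b"
    using product_exists[OF reg] obs by blast
  have ab: "a \<in> hom C XX X" "b \<in> hom C XX X"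
    using XX by (auto simp: is_product_def)
  obtain A d c where A: "is_product C XX Y A d c"
    using product_exists[OF reg] obs hom_Ob[OF ab(1)] by blast
  have dc: "d \<in> hom C A XX" "c \<in> hom C A Y"
    using A by (auto simp: is_product_def)
  obtain ZZ i j where ZZ: "is_product C Z Z ZZ i j"
    using product_exists[OF reg] obs by blast
  have ij: "i \<in> hom C ZZ Z" "j \<in> hom C ZZ Z"
    using ZZ by (auto simp: is_product_def)
  have proj: "product_projection C A XX d"
    using A unfolding product_projection_def by blast
  have pq: "p \<in> hom C P X" "q \<in> hom C P Y"
    using prod by (auto simp: is_product_def)
  have un: "\<And>S u v. \<lbrakk>u \<in> hom C S P; v \<in> hom C S P; p \<cdot> u = p \<cdot> v; q \<cdot> u = q \<cdot> v\<rbrakk> \<Longrightarrow> u = v"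
    using prod by (rule productE) blast
  define F G where "F = pairing C p q (a \<cdot> d) c" and "G = pairing C p q (b \<cdot> d) c"
  have ad: "a \<cdot> d \<in> hom C A X" and bd: "b \<cdot> d \<in> hom C A X"
    using Comp_in_hom[OF dc(1) ab(1)] Comp_in_hom[OF dc(1) ab(2)] .
  note F = pairing[OF prod ad dc(2), folded F_def] and G = pairing[OF prod bd dc(2), folded G_def]
  have fF: "f \<cdot> F \<in> hom C A Z" and fG: "f \<cdot> G \<in> hom C A Z"
    using Comp_in_hom[OF F(1) f] Comp_in_hom[OF G(1) f] .
  define g where "g = pairing C i j (f \<cdot> F) (f \<cdot> G)"
  note g = pairing[OF ZZ fF fG, folded g_def]
  \<comment> \<open>For \<open>w = (a, b, c)\<close>: \<open>F w = (a, c)\<close> and \<open>G w = (b, c)\<close>, and \<open>f\<close> makes these the components of \<open>g w\<close>.\<close>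
  have Fval: "F \<cdot> w = pairing C p q x0 y0"
    if w: "w \<in> hom C S' A" and "x0 \<in> hom C S' X" "y0 \<in> hom C S' Y"
      and e: "a \<cdot> (d \<cdot> w) = x0" "c \<cdot> w = y0" for S' w x0 y0
  proof (rule un)
    show "F \<cdot> w \<in> hom C S' P"
      using Comp_in_hom[OF w F(1)] .
    show "pairing C p q x0 y0 \<in> hom C S' P"
      using pairing(1)[OF prod that(2,3)] .
    show "p \<cdot> (F \<cdot> w) = p \<cdot> pairing C p q x0 y0"
      using pairing(2)[OF prod that(2,3)] Comp_assoc[OF w F(1) pq(1)] F(2)
        Comp_assoc[OF w dc(1) ab(1)] e by simp
    show "q \<cdot> (F \<cdot> w) = q \<cdot> pairing C p q x0 y0"
      using pairing(3)[OF prod that(2,3)] Comp_assoc[OF w F(1) pq(2)] F(3) e by simp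
  qed
  have Gval: "G \<cdot> w = pairing C p q x0 y0"
    if w: "w \<in> hom C S' A" and "x0 \<in> hom C S' X" "y0 \<in> hom C S' Y"
      and e: "b \<cdot> (d \<cdot> w) = x0" "c \<cdot> w = y0" for S' w x0 y0
  proof (rule un)
    show "G \<cdot> w \<in> hom C S' P"
      using Comp_in_hom[OF w G(1)] .
    show "pairing C p q x0 y0 \<in> hom C S' P"
      using pairing(1)[OF prod that(2,3)] .
    show "p \<cdot> (G \<cdot> w) = p \<cdot> pairing C p q x0 y0"
      using pairing(2)[OF prod that(2,3)] Comp_assoc[OF w G(1) pq(1)] G(2)
        Comp_assoc[OF w dc(1) ab(2)] e by simp
    show "q \<cdot> (G \<cdot> w) = q \<cdot> pairing C p q x0 y0"
      using pairing(3)[OF prod that(2,3)] Comp_assoc[OF w G(1) pq(2)] G(3) e by simp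
  qed
  have ig: "i \<cdot> (g \<cdot> w) = f \<cdot> (F \<cdot> w)" and jg: "j \<cdot> (g \<cdot> w) = f \<cdot> (G \<cdot> w)"
    if w: "w \<in> hom C S' A" for S' w
    using Comp_assoc[OF w g(1) ij(1)] Comp_assoc[OF w g(1) ij(2)] g(2,3)
      Comp_assoc[OF w F(1) f] Comp_assoc[OF w G(1) f] by simp_all
  \<comment> \<open>The three points \<open>(x, x', y)\<close>, \<open>(x, x', n)\<close> and \<open>(x, x, n)\<close>\<close>
  define xx' xx where "xx' = pairing C a b x x'" and "xx = pairing C a b x x"
  note xx' = pairing[OF XX x x', folded xx'_def] and xx = pairing[OF XX x x, folded xx_def]
  define s t r where "s = pairing C d c xx' y" and "t = pairing C d c xx' n"
    and "r = pairing C d c xx n"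
  note s = pairing[OF A xx'(1) y, folded s_def] and t = pairing[OF A xx'(1) n, folded t_def]
    and r = pairing[OF A xx(1) n, folded r_def]
  have "g \<cdot> t = g \<cdot> r"
    using ZZ
  proof (rule productE)
    assume unZ: "\<And>S u v. \<lbrakk>u \<in> hom C S ZZ; v \<in> hom C S ZZ; i \<cdot> u = i \<cdot> v; j \<cdot> u = j \<cdot> v\<rbrakk> \<Longrightarrow> u = v"
    show ?thesis
    proof (rule unZ)
      show "g \<cdot> t \<in> hom C S ZZ" "g \<cdot> r \<in> hom C S ZZ"
        using Comp_in_hom[OF t(1) g(1)] Comp_in_hom[OF r(1) g(1)] .
      show "i \<cdot> (g \<cdot> t) = i \<cdot> (g \<cdot> r)"
        using ig[OF t(1)] ig[OF r(1)] Fval[OF t(1) x n] Fval[OF r(1) x n] t r xx xx' by simp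
      show "j \<cdot> (g \<cdot> t) = j \<cdot> (g \<cdot> r)"
        using jg[OF t(1)] jg[OF r(1)] Gval[OF t(1) x' n] Gval[OF r(1) x n] t r xx xx' eq by simp
    qed
  qed
  moreover have "d \<cdot> s = d \<cdot> t"
    using s t by simp
  ultimately obtain S' k w where k: "k \<in> hom C S' S" "regular_epi C k" and w: "w \<in> hom C S' A"
    and gw: "g \<cdot> w = g \<cdot> (s \<cdot> k)" and dw: "d \<cdot> w = d \<cdot> (r \<cdot> k)"
    using factor_permutability_on_elements[OF fp proj dc(1) g(1) s(1) t(1) r(1)] by blast
  have sk: "s \<cdot> k \<in> hom C S' A"
    using Comp_in_hom[OF k(1) s(1)] .
  \<comment> \<open>\<open>w\<close> lies over the diagonal of \<open>X \<times> X\<close>, where \<open>F\<close> and \<open>G\<close> agree whatever its \<open>Y\<close>-coordinate is.\<close>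
  have dw': "d \<cdot> w = xx \<cdot> k"
    using dw Comp_assoc[OF k(1) r(1) dc(1)] r(2) by simp
  have xk: "x \<cdot> k \<in> hom C S' X" and cw: "c \<cdot> w \<in> hom C S' Y"
    using Comp_in_hom[OF k(1) x] Comp_in_hom[OF w dc(2)] .
  have "a \<cdot> (d \<cdot> w) = x \<cdot> k" "b \<cdot> (d \<cdot> w) = x \<cdot> k"
    unfolding dw' using Comp_assoc[OF k(1) xx(1) ab(1)] Comp_assoc[OF k(1) xx(1) ab(2)] xx by simp_all
  then have "F \<cdot> w = G \<cdot> w"
    using Fval[OF w xk cw] Gval[OF w xk cw] by simp
  then have "f \<cdot> (F \<cdot> (s \<cdot> k)) = f \<cdot> (G \<cdot> (s \<cdot> k))"
    using ig[OF w] jg[OF w] ig[OF sk] jg[OF sk] gw by simp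
  moreover have "F \<cdot> (s \<cdot> k) = pairing C p q x y \<cdot> k" "G \<cdot> (s \<cdot> k) = pairing C p q x' y \<cdot> k"
    using Comp_assoc[OF k(1) s(1) F(1)] Comp_assoc[OF k(1) s(1) G(1)]
      Fval[OF s(1) x y] Gval[OF s(1) x' y] s xx' by simp_all
  moreover note xy = pairing(1)[OF prod x y] and x'y = pairing(1)[OF prod x' y]
  ultimately have "(f \<cdot> pairing C p q x y) \<cdot> k = (f \<cdot> pairing C p q x' y) \<cdot> k"
    using Comp_assoc[OF k(1) xy f] Comp_assoc[OF k(1) x'y f] by simp
  then show ?thesis
    using regular_epi_cancel[OF k(2,1) Comp_in_hom[OF xy f] Comp_in_hom[OF x'y f]] by blast
qed

lemma factor_permutable_condition_S:
  assumes pt: "pointed_category C" and fp: "factor_permutable C"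
  shows "condition_S C"
  unfolding condition_S_def
proof (intro allI impI ballI)
  fix X P p q W Y m \<phi> f
  assume "is_product C X X P p q \<and> m \<in> hom C W Y \<and> monic C m"
  then have prod: "is_product C X X P p q" and m: "m \<in> hom C W Y" "monic C m"
    by auto
  assume \<phi>: "\<phi> \<in> hom C P Y" and f: "f \<in> hom C X W"
  define i1 where "i1 = pairing C p q (Ident C X) (zero_morphism C X X)"
  define i2 where "i2 = pairing C p q (zero_morphism C X X) (Ident C X)"
  assume "\<phi> \<cdot> pairing C p q (Ident C X) (zero_morphism C X X) = m \<cdot> f \<and>
    m \<cdot> f = \<phi> \<cdot> pairing C p q (zero_morphism C X X) (Ident C X)"
  then have \<phi>1: "\<phi> \<cdot> i1 = m \<cdot> f" and \<phi>2: "\<phi> \<cdot> i2 = m \<cdot> f"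
    by (simp_all add: i1_def i2_def)
  have X: "X \<in> Ob C"
    using hom_Ob[OF f] by blast
  note id = Ident_in_hom[OF X] and zero = zero_morphism_in_hom[OF pt X X]
  note i1 = pairing[OF prod id zero, folded i1_def]
    and i2 = pairing[OF prod zero id, folded i2_def]
  have p: "p \<in> hom C P X" and q: "q \<in> hom C P X"
    using prod by (auto simp: is_product_def)
  have P: "P \<in> Ob C"
    using hom_Ob[OF p] by blast
  note idP = Ident_in_hom[OF P]
  have proj: "product_projection C P X q"
    using prod unfolding product_projection_def by blast
  have i1q: "i1 \<cdot> q \<in> hom C P P" and i2q: "i2 \<cdot> q \<in> hom C P P"
    using Comp_in_hom[OF q i1(1)] Comp_in_hom[OF q i2(1)] .
  \<comment> \<open>The points \<open>(a, b)\<close>, \<open>(0, b)\<close> and \<open>(b, 0)\<close>, for the generic element \<open>(a, b)\<close> of \<open>X \<times> X\<close>\<close>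
  have "q \<cdot> Ident C P = q \<cdot> (i2 \<cdot> q)"
    using Comp_Ident[OF q] Comp_assoc[OF q i2(1) q] i2(3) Ident_Comp[OF q] by simp
  moreover have "\<phi> \<cdot> (i2 \<cdot> q) = \<phi> \<cdot> (i1 \<cdot> q)"
    using Comp_assoc[OF q i2(1) \<phi>] Comp_assoc[OF q i1(1) \<phi>] \<phi>1 \<phi>2 by simp
  ultimately obtain S c w where c: "c \<in> hom C S P" "regular_epi C c" and w: "w \<in> hom C S P"
    and \<phi>w: "\<phi> \<cdot> w = \<phi> \<cdot> (Ident C P \<cdot> c)" and qw: "q \<cdot> w = q \<cdot> ((i1 \<cdot> q) \<cdot> c)"
    using factor_permutability_on_elements[OF fp proj q \<phi> idP i2q i1q] by blast
  have qc: "q \<cdot> c \<in> hom C S X" and pw: "p \<cdot> w \<in> hom C S X"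
    using Comp_in_hom[OF c(1) q] Comp_in_hom[OF w p] .
  \<comment> \<open>The second coordinate of \<open>w\<close> is that of \<open>(b, 0)\<close>, so \<open>w\<close> lies on the first axis.\<close>
  have "w = i1 \<cdot> (p \<cdot> w)"
    using prod
  proof (rule productE)
    assume un: "\<And>S u v. \<lbrakk>u \<in> hom C S P; v \<in> hom C S P; p \<cdot> u = p \<cdot> v; q \<cdot> u = q \<cdot> v\<rbrakk> \<Longrightarrow> u = v"
    show ?thesis
    proof (rule un[OF w Comp_in_hom[OF pw i1(1)]])
      show "p \<cdot> w = p \<cdot> (i1 \<cdot> (p \<cdot> w))"
        using Comp_assoc[OF pw i1(1) p] i1(2) Ident_Comp[OF pw] by simp
      have "q \<cdot> w = zero_morphism C S X"
        using qw Comp_assoc[OF c(1) q i1(1)] Comp_assoc[OF qc i1(1) q] i1(3)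
          zero_morphism_comp[OF pt qc X] by simp
      then show "q \<cdot> w = q \<cdot> (i1 \<cdot> (p \<cdot> w))"
        using Comp_assoc[OF pw i1(1) q] i1(3) zero_morphism_comp[OF pt pw X] by simp
    qed
  qed
  then have "\<phi> \<cdot> w = m \<cdot> (f \<cdot> (p \<cdot> w))"
    using Comp_assoc[OF pw i1(1) \<phi>] \<phi>1 Comp_assoc[OF pw f m(1)] by simp
  then have "m \<cdot> (f \<cdot> (p \<cdot> w)) = \<phi> \<cdot> c"
    using \<phi>w Ident_Comp[OF c(1)] by simp
  then show "\<exists>\<psi> \<in> hom C P W. m \<cdot> \<psi> = \<phi>"
    using regular_epi_lifts_against_monic[OF c(2,1) m(2,1) \<phi> Comp_in_hom[OF pw f]] by blast
qed

end

theorem proposition3p23: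
  fixes C :: "('o, 'm) precategory"
  assumes "pointed_category C"
    and "factor_permutable C"
  shows "strongly_centralic C"
proof -
  have reg: "regular_category C"
    using assms(2) by (simp add: factor_permutable_def)
  then interpret category C
    by (simp add: regular_category_def)
  have "centralic C"
    unfolding centralic_def
  proof (intro conjI allI impI ballI)
    show "has_finite_products C"
      using reg by (simp add: regular_category_def finitely_complete_def)
  next
    fix X Y P p q Z S f x x' y
    assume prod: "is_product C X Y P p q" and f: "f \<in> hom C P Z"
      and x: "x \<in> hom C S X" "x' \<in> hom C S X" and y: "y \<in> hom C S Y"
      and eq: "f \<cdot>\<^bsub>C\<^esub> pairing C p q x (zero_morphism C S Y) =
        f \<cdot>\<^bsub>C\<^esub> pairing C p q x' (zero_morphism C S Y)"
    have "zero_morphism C S Y \<in> hom C S Y"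
      using zero_morphism_in_hom[OF assms(1)] hom_Ob[OF y] by blast
    then show "f \<cdot>\<^bsub>C\<^esub> pairing C p q x y = f \<cdot>\<^bsub>C\<^esub> pairing C p q x' y"
      using factor_permutable_shift[OF assms(2) prod f x y _ eq] by blast
  qed (rule assms(1))
  then show ?thesis
    unfolding strongly_centralic_def
    using assms factor_permutable_condition_S by blast
qed

end
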